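(* Let $\pi:\tilde X\to X$ be the minimal resolution of a germ of a normal surface singularity $(X,O)$ and let $A=(a_{i,j})$ be the $n\times n$ symmetric intersection matrix of the exceptional set. Assume that $X$ has a polygon singularity, i.e. the dual graph of the exceptional set is a star with root $E_n$ and all other vertices $E_1,\dots,E_{n-1}$ are leaves. Put $$\Delta_n=a_{n,n}-\sum_{i=1}^{n-1}\frac{a_{i,n}^2}{a_{i,i}} .$$ Then $(NN)$ is true if and only if all of the following conditions hold: (1) $a_{i,i}+a_{i,n}<0$ for all $i=1,\dots,n-1$; (2) $a_{i,i}a_{j,j}\Delta_n+a_{j,n}(a_{i,i}a_{j,n}-a_{j,j}a_{i,n})<0$ for all $i,j=1,\dots,n-1$; (3) $\dfrac{a_{i,n}}{a_{i,i}}(a_{i,i}+a_{i,n})+\Delta_n<0$ for all $i=1,\dots,n-1$. Moreover, a symmetric matrix $A$ of this shape (with $a_{i,i}<0$ for $i\le n-1$ and $a_{i,j}=0$ for distinct $i,j\le n-1$) is negative definite if and only if $\Delta_n<0$.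
   Context: Setting: $(X,O)$ is a germ of a normal surface singularity (over $\mathbb C$), $\pi:\tilde X\to X$ its minimal resolution, $E_1,\dots,E_n$ the irreducible components of the exceptional divisor, $K_{\tilde X}$ the canonical divisor of $\tilde X$. The intersection matrix $A=(a_{i,j})$, $a_{i,j}=E_i\cdot E_j$, is symmetric, negative definite, with integer entries, $a_{i,i}<0$ and $a_{i,j}\ge0$ for $i\neq j$. The dual graph has vertices $E_1,\dots,E_n$ and an edge between $E_i$ and $E_j$ ($i\ne j$) iff $a_{i,j}\neq0$. The star hypothesis means: $a_{i,n}>0$ for $i=1,\dots,n-1$ and $a_{i,j}=0$ for distinct $i,j\in\{1,\dots,n-1\}$. Minimality gives $K_{\tilde X}\cdot E_i\ge0$ for all $i$. For $i\ne j$, $(NN_{(i,j)})$ is the condition: there exist positive integers $n_1,\dots,n_n$ with $n_i<n_j$ such that $\sum_{l=1}^n n_l\,a_{l,k}\le -2K_{\tilde X}\cdot E_k$ for all $k=1,\dots,n$. Condition $(NN)$ means that $(NN_{(i,j)})$ holds for all ordered pairs $(i,j)$ with $i\neq j$. *)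

theory Defs
  imports "HOL-Analysis.Analysis"
begin

definition negative_definite :: "real^'n^'n \<Rightarrow> bool" where
  "negative_definite M \<longleftrightarrow> (\<forall>x. x \<noteq> 0 \<longrightarrow> x \<bullet> (M *v x) < 0)"

text \<open>
  The numerical data of the minimal resolution of a normal surface singularity. The index type
  \<^typ>\<open>'n\<close> labels the exceptional components, so that \<open>n = CARD('n)\<close>; the entries of \<open>A\<close> are the
  intersection numbers of these components and \<open>K $ i\<close> is the intersection number of the canonical
  divisor with the component \<open>i\<close>. Complex surface germs are not available in the libraries, so the
  surface itself is not modelled. By adjunction, \<open>K $ i\<close> equals \<open>2 p - 2 - A $ i $ i\<close>, where the
  natural number \<open>p\<close> is the arithmetic genus of the irreducible curve \<open>i\<close>; the condition
  \<open>0 \<le> K $ i\<close> is minimality. By Grauert's contraction theorem, applied to a plumbing of smooth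
  curves, all such data with connected dual graph come from a minimal resolution.
\<close>
locale minimal_resolution_data =
  fixes A :: "int^'n^'n" and K :: "int^'n"
  assumes symmetric: "transpose A = A"
    and neg_def: "negative_definite (map_matrix real_of_int A)"
    and off_diag_nonneg: "i \<noteq> j \<Longrightarrow> 0 \<le> A $ i $ j"
    and adjunction: "\<exists>p::nat. K $ i = 2 * int p - 2 - A $ i $ i"
    and minimal: "0 \<le> K $ i"

definition dual_graph :: "int^'n^'n \<Rightarrow> 'n \<Rightarrow> 'n \<Rightarrow> bool" where
  "dual_graph A i j \<longleftrightarrow> i \<noteq> j \<and> A $ i $ j \<noteq> 0"

definition is_star :: "('v \<Rightarrow> 'v \<Rightarrow> bool) \<Rightarrow> 'v \<Rightarrow> bool" where
  "is_star G r \<longleftrightarrow> (\<forall>i j. G i j \<longleftrightarrow> i \<noteq> j \<and> (i = r \<or> j = r))"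

definition NN_pair :: "int^'n^'n \<Rightarrow> int^'n \<Rightarrow> 'n \<Rightarrow> 'n \<Rightarrow> bool" where
  "NN_pair A K i j \<longleftrightarrow>
    (\<exists>m::int^'n. (\<forall>l. 0 < m $ l) \<and> m $ i < m $ j \<and>
      (\<forall>k. (\<Sum>l\<in>UNIV. m $ l * A $ l $ k) \<le> - 2 * K $ k))"

definition NN :: "int^'n^'n \<Rightarrow> int^'n \<Rightarrow> bool" where
  "NN A K \<longleftrightarrow> (\<forall>i j. i \<noteq> j \<longrightarrow> NN_pair A K i j)"

definition star_Delta :: "real^'n^'n \<Rightarrow> 'n \<Rightarrow> real" where
  "star_Delta M r = M $ r $ r - (\<Sum>i\<in>UNIV - {r}. (M $ i $ r)\<^sup>2 / M $ i $ i)"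

lemma (in minimal_resolution_data) diag_neg: "A $ i $ i < 0"
proof -
  have "axis i 1 \<bullet> (map_matrix real_of_int A *v axis i 1) < 0"
    using neg_def unfolding negative_definite_def by (simp add: axis_eq_0_iff)
  then show ?thesis
    by (simp add: matrix_vector_mult_basis column_def map_matrix_def inner_axis')
qed

lemma (in minimal_resolution_data) is_star_dual_graph_iff:
  "is_star (dual_graph A) r \<longleftrightarrow>
    (\<forall>i. i \<noteq> r \<longrightarrow> 0 < A $ i $ r) \<and>
    (\<forall>i j. i \<noteq> r \<longrightarrow> j \<noteq> r \<longrightarrow> i \<noteq> j \<longrightarrow> A $ i $ j = 0)"
proof -
  have "transpose A $ i $ j = A $ i $ j" for i j
    by (simp only: symmetric)
  then have sym: "A $ i $ j = A $ j $ i" for i j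
    by (simp add: transpose_def)
  have pos: "0 < A $ i $ j \<longleftrightarrow> A $ i $ j \<noteq> 0" if "i \<noteq> j" for i j
    using off_diag_nonneg[OF that] by auto
  show ?thesis
  proof
    assume star: "is_star (dual_graph A) r"
    show "(\<forall>i. i \<noteq> r \<longrightarrow> 0 < A $ i $ r) \<and>
      (\<forall>i j. i \<noteq> r \<longrightarrow> j \<noteq> r \<longrightarrow> i \<noteq> j \<longrightarrow> A $ i $ j = 0)"
      using star pos unfolding is_star_def dual_graph_def by blast
  next
    assume shape: "(\<forall>i. i \<noteq> r \<longrightarrow> 0 < A $ i $ r) \<and>
      (\<forall>i j. i \<noteq> r \<longrightarrow> j \<noteq> r \<longrightarrow> i \<noteq> j \<longrightarrow> A $ i $ j = 0)"
    have "dual_graph A i j \<longleftrightarrow> i \<noteq> j \<and> (i = r \<or> j = r)" for i j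
      using shape sym[of i j] unfolding dual_graph_def
      by (cases "i = r"; cases "j = r") auto
    then show "is_star (dual_graph A) r"
      unfolding is_star_def by blast
  qed
qed

end

theory Submission
  imports Defs
begin

text \<open>
  Write \<open>c l = - a l r / a l l\<close> for a leaf \<open>l\<close>, \<open>c r = 1\<close>, and \<open>u l = x l - c l * x r\<close>. In these
  coordinates the leaf entries of \<open>x A\<close> become \<open>a k k * u k\<close>, the root entry becomes
  \<open>\<Delta> * x r + (\<Sum>l. a l r * u l)\<close>, and the quadratic form of \<open>A\<close> becomes diagonal with entry \<open>\<Delta>\<close> at
  the root. Since a real solution of the strict homogeneous inequalities can be scaled up and rounded
  to an integral one absorbing any right-hand side, \<open>NN_pair A K i j\<close> asks for \<open>u \<ge> 0\<close> with
  \<open>\<Delta> + (\<Sum>l. a l r * u l) < 0\<close> and \<open>c i + u i < c j + u j\<close> (normalising \<open>x r = 1\<close>), where it is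
  best to take \<open>u\<close> supported at \<open>j\<close>.
\<close>

section \<open>From strict real solutions to integral ones\<close>

text \<open>Multiplying \<open>x\<close> by a large \<open>N\<close> pushes every column sum below
  any bound, while rounding up afterwards changes it only by an amount independent of
  \<open>N\<close>.\<close>

lemma NN_pair_if_strict_real_solution:
  fixes A :: "int^'n^'n" and K :: "int^'n" and x :: "'n \<Rightarrow> real"
  assumes pos: "\<And>l. 0 < x l"
    and less: "x i < x j"
    and neg: "\<And>k. (\<Sum>l\<in>UNIV. x l * real_of_int (A $ l $ k)) < 0"
  shows "NN_pair A K i j"
proof -
  define s where "s k = (\<Sum>l\<in>UNIV. x l * real_of_int (A $ l $ k))" for k
  \<comment> \<open>Moving each coordinate by at most 1 changes the sum for column \<open>k\<close>
    by at most \<open>e k\<close>.\<close>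
  define e where "e k = (\<Sum>l\<in>UNIV. real_of_int \<bar>A $ l $ k\<bar>)" for k
  have tendsto: "LIM N at_top. N * d :> at_top" if "0 < d" for d :: real
    by (rule filterlim_at_top_mult_tendsto_pos[OF tendsto_const that filterlim_ident])
  \<comment> \<open>A gap above 1 between the scaled entries at \<open>i\<close> and
    \<open>j\<close> survives rounding up.\<close>
  have "eventually (\<lambda>N. 0 < N \<and> 1 < N * (x j - x i) \<and>
      (\<forall>k. e k + 2 * real_of_int (K $ k) < N * - s k)) at_top"
    using less neg
    by (intro eventually_conj eventually_all_finite eventually_gt_at_top
        eventually_compose_filterlim[OF eventually_gt_at_top tendsto]) (simp_all add: s_def)
  then obtain N where N: "0 < N" "1 < N * (x j - x i)"
      "\<And>k. e k + 2 * real_of_int (K $ k) < N * - s k"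
    unfolding eventually_at_top_linorder by blast
  define m :: "int^'n" where "m = (\<chi> l. \<lceil>N * x l\<rceil>)"
  have m_lower: "N * x l \<le> m $ l" and m_upper: "m $ l < N * x l + 1" for l
    unfolding m_def by simp_all linarith
  have "0 < m $ l" for l
    using pos N(1) by (simp add: m_def)
  moreover have "m $ i < m $ j"
    using m_upper[of i] m_lower[of j] N(2) by (simp add: algebra_simps)
  moreover have "(\<Sum>l\<in>UNIV. m $ l * A $ l $ k) \<le> - 2 * K $ k" for k
  proof -
    have "real_of_int (m $ l * A $ l $ k) \<le>
        N * (x l * real_of_int (A $ l $ k)) + real_of_int \<bar>A $ l $ k\<bar>" for l
    proof -
      have "\<bar>real_of_int (m $ l) - N * x l\<bar> * \<bar>real_of_int (A $ l $ k)\<bar>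
          \<le> 1 * \<bar>real_of_int (A $ l $ k)\<bar>"
        using m_lower[of l] m_upper[of l] by (intro mult_right_mono) auto
      then have "(real_of_int (m $ l) - N * x l) * real_of_int (A $ l $ k)
          \<le> \<bar>real_of_int (A $ l $ k)\<bar>"
        by (simp only: abs_mult[symmetric] mult_1 abs_le_iff)
      then show ?thesis
        by (simp add: algebra_simps)
    qed
    then have "(\<Sum>l\<in>UNIV. real_of_int (m $ l * A $ l $ k)) \<le>
        (\<Sum>l\<in>UNIV. N * (x l * real_of_int (A $ l $ k)) + real_of_int \<bar>A $ l $ k\<bar>)"
      by (intro sum_mono)
    also have "\<dots> = N * s k + e k"
      by (simp add: s_def e_def sum.distrib sum_distrib_left)
    finally have "real_of_int (\<Sum>l\<in>UNIV. m $ l * A $ l $ k) \<le> real_of_int (- 2 * K $ k)"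
      using N(3)[of k] by simp
    then show ?thesis
      by (simp only: of_int_le_iff)
  qed
  ultimately show ?thesis
    unfolding NN_pair_def by blast
qed

section \<open>Linear algebra of star-shaped symmetric matrices\<close>

locale star_matrix =
  fixes M :: "real^'n^'n" and r :: 'n
  assumes symmetric: "transpose M = M"
    and leaf_diag_neg: "i \<noteq> r \<Longrightarrow> M $ i $ i < 0"
    and leaf_off_diag: "i \<noteq> r \<Longrightarrow> j \<noteq> r \<Longrightarrow> i \<noteq> j \<Longrightarrow> M $ i $ j = 0"
begin

text \<open>The vector with root entry 1 whose product with \<open>M\<close> vanishes at every leaf;
  its root entry is then \<open>star_Delta M r\<close>.\<close>

definition c :: "'n \<Rightarrow> real" where
  "c l = (if l = r then 1 else - M $ l $ r / M $ l $ l)"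

lemma c_root [simp]: "c r = 1"
  by (simp add: c_def)

lemma entry_eq: "l \<noteq> r \<Longrightarrow> M $ l $ r = - M $ l $ l * c l"
  using leaf_diag_neg[of l] by (simp add: c_def)

lemma sym: "M $ i $ j = M $ j $ i"
  using arg_cong[OF symmetric, of "\<lambda>M. M $ j $ i"] by (simp add: transpose_def)

lemma sum_root_split:
  "(\<Sum>l\<in>UNIV. f l) = f r + (\<Sum>l\<in>UNIV - {r}. f l)" for f :: "'n \<Rightarrow> real"
  by (simp add: sum.remove)

lemma Delta_eq: "star_Delta M r = M $ r $ r + (\<Sum>l\<in>UNIV - {r}. M $ l $ r * c l)"
proof -
  have "(\<Sum>l\<in>UNIV - {r}. (M $ l $ r)\<^sup>2 / M $ l $ l) = - (\<Sum>l\<in>UNIV - {r}. M $ l $ r * c l)"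
    unfolding sum_negf[symmetric] by (intro sum.cong) (auto simp: c_def power2_eq_square)
  then show ?thesis
    by (simp add: star_Delta_def)
qed

lemma row_leaf:
  assumes "k \<noteq> r"
  shows "(\<Sum>l\<in>UNIV. x l * M $ l $ k) = M $ k $ k * (x k - c k * x r)"
proof -
  have "(\<Sum>l\<in>UNIV - {r}. x l * M $ l $ k) = (\<Sum>l\<in>{k}. x l * M $ l $ k)"
    using assms leaf_off_diag by (intro sum.mono_neutral_right) auto
  then show ?thesis
    using entry_eq[OF assms] by (simp add: sum_root_split sym[of r k] algebra_simps)
qed

lemma row_root:
  "(\<Sum>l\<in>UNIV. x l * M $ l $ r) =
    star_Delta M r * x r + (\<Sum>l\<in>UNIV - {r}. M $ l $ r * (x l - c l * x r))"
  by (simp add: sum_root_split Delta_eq sum_subtractf sum_distrib_left sum_distrib_right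
      algebra_simps)

text \<open>Completing the square at each leaf: since \<open>M $ l $ r = - M $ l $ l * c l\<close>,
  the part of the root term coming from \<open>l\<close> and the leaf term of \<open>l\<close>
  combine to a multiple of one square.\<close>

lemma quadratic_form:
  "x \<bullet> (M *v x) =
    star_Delta M r * (x $ r)\<^sup>2 + (\<Sum>l\<in>UNIV - {r}. M $ l $ l * (x $ l - c l * x $ r)\<^sup>2)"
proof -
  have row: "(M *v x) $ k = (\<Sum>l\<in>UNIV. x $ l * M $ l $ k)" for k
    by (simp add: matrix_vector_mult_def sym[of k] mult.commute)
  have root: "(M *v x) $ r =
      star_Delta M r * x $ r + (\<Sum>l\<in>UNIV - {r}. M $ l $ r * (x $ l - c l * x $ r))"
    unfolding row by (rule row_root)
  have leaf: "(M *v x) $ k = M $ k $ k * (x $ k - c k * x $ r)" if "k \<noteq> r" for k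
    unfolding row by (rule row_leaf[OF that])
  have "x \<bullet> (M *v x) = (\<Sum>k\<in>UNIV. x $ k * (M *v x) $ k)"
    by (simp add: inner_vec_def)
  also have "\<dots> = star_Delta M r * (x $ r)\<^sup>2 +
      ((\<Sum>l\<in>UNIV - {r}. x $ r * (M $ l $ r * (x $ l - c l * x $ r))) +
       (\<Sum>l\<in>UNIV - {r}. x $ l * (M $ l $ l * (x $ l - c l * x $ r))))"
    by (simp add: sum_root_split[of "\<lambda>k. x $ k * (M *v x) $ k"] root leaf
        sum_distrib_left distrib_left power2_eq_square mult.left_commute)
  also have "(\<Sum>l\<in>UNIV - {r}. x $ r * (M $ l $ r * (x $ l - c l * x $ r))) +
       (\<Sum>l\<in>UNIV - {r}. x $ l * (M $ l $ l * (x $ l - c l * x $ r))) =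
       (\<Sum>l\<in>UNIV - {r}. M $ l $ l * (x $ l - c l * x $ r)\<^sup>2)"
    unfolding sum.distrib[symmetric]
    by (intro sum.cong) (auto simp: entry_eq power2_eq_square algebra_simps)
  finally show ?thesis .
qed

lemma negative_definite_iff: "negative_definite M \<longleftrightarrow> star_Delta M r < 0"
proof
  assume "negative_definite M"
  \<comment> \<open>All leaf squares vanish at \<open>c\<close>, so the form takes the value
    \<open>star_Delta M r\<close> there.\<close>
  moreover define v where "v = (\<chi> l. c l)"
  moreover have "v $ r = 1"
    by (simp add: v_def)
  then have "v \<noteq> 0"
    by auto
  ultimately have "v \<bullet> (M *v v) < 0"
    by (simp add: negative_definite_def)
  then show "star_Delta M r < 0"
    by (simp add: quadratic_form v_def)
next
  assume Delta: "star_Delta M r < 0"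
  show "negative_definite M"
    unfolding negative_definite_def
  proof (intro allI impI)
    fix x :: "real^'n"
    assume "x \<noteq> 0"
    have nonpos: "M $ l $ l * (x $ l - c l * x $ r)\<^sup>2 \<le> 0" if "l \<noteq> r" for l
      using leaf_diag_neg[OF that] by (simp add: mult_nonpos_nonneg)
    then have sum_nonpos: "(\<Sum>l\<in>UNIV - {r}. M $ l $ l * (x $ l - c l * x $ r)\<^sup>2) \<le> 0"
      by (intro sum_nonpos) auto
    show "x \<bullet> (M *v x) < 0"
    proof (cases "x $ r = 0")
      case False
      then have "star_Delta M r * (x $ r)\<^sup>2 < 0"
        using Delta by (simp add: mult_neg_pos)
      then show ?thesis
        using sum_nonpos by (simp add: quadratic_form)
    next
      \<comment> \<open>The root term is lost here, so strictness must come from a leaf with nonzero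
        coordinate.\<close>
      case True
      obtain l where l: "x $ l \<noteq> 0"
        using \<open>x \<noteq> 0\<close> by (auto simp: vec_eq_iff)
      with True have "l \<noteq> r"
        by auto
      have "M $ l $ l * (x $ l - c l * x $ r)\<^sup>2 < 0"
        using leaf_diag_neg[OF \<open>l \<noteq> r\<close>] l True by (simp add: mult_neg_pos)
      then have "(\<Sum>l\<in>UNIV - {r}. M $ l $ l * (x $ l - c l * x $ r)\<^sup>2) < (\<Sum>l\<in>UNIV - {r}. 0)"
        using nonpos \<open>l \<noteq> r\<close> by (intro sum_strict_mono_ex1) auto
      then show ?thesis
        using True by (simp add: quadratic_form)
    qed
  qed
qed

end

section \<open>The pair conditions for a star-shaped dual graph\<close>

locale star_resolution =
  minimal_resolution_data A K for A :: "int^'n^'n" and K :: "int^'n" +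
  fixes r :: 'n
  assumes star: "is_star (dual_graph A) r"
begin

sublocale star_matrix "map_matrix real_of_int A" r
proof
  show "transpose (map_matrix real_of_int A) = map_matrix real_of_int A"
    using symmetric by (simp add: vec_eq_iff transpose_def map_matrix_def)
qed (use star diag_neg in \<open>auto simp: is_star_dual_graph_iff map_matrix_def\<close>)

abbreviation a :: "'n \<Rightarrow> 'n \<Rightarrow> real" where
  "a i j \<equiv> real_of_int (A $ i $ j)"

abbreviation \<Delta> :: real where
  "\<Delta> \<equiv> star_Delta (map_matrix real_of_int A) r"

lemma entry [simp]: "map_matrix real_of_int A $ i $ j = a i j"
  by (simp add: map_matrix_def)

lemma Delta_neg: "\<Delta> < 0"
  using neg_def negative_definite_iff by simp

lemma edge_pos: "i \<noteq> r \<Longrightarrow> 0 < a i r"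
  using star by (simp add: is_star_dual_graph_iff)

lemma c_pos: "0 < c l"
  using edge_pos[of l] diag_neg[of l] by (auto simp: c_def divide_pos_neg)

text \<open>Minimality makes all right-hand sides nonpositive, so the system becomes homogeneous and
  can be divided by its root coordinate. The root inequality stays weak, because \<open>K\<close>
  may vanish at the root.\<close>

lemma NN_pair_imp:
  assumes "NN_pair A K i j"
  obtains u where "u r = 0" "\<forall>l. 0 \<le> u l" "\<Delta> + (\<Sum>l\<in>UNIV - {r}. a l r * u l) \<le> 0"
    "c i + u i < c j + u j"
proof -
  from assms obtain m :: "int^'n" where pos: "\<And>l. 0 < m $ l" and less: "m $ i < m $ j"
    and le: "\<And>k. (\<Sum>l\<in>UNIV. m $ l * A $ l $ k) \<le> - 2 * K $ k"
    unfolding NN_pair_def by blast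
  define x where "x l = real_of_int (m $ l)" for l
  have row: "(\<Sum>l\<in>UNIV. x l * a l k) \<le> 0" for k
  proof -
    have "real_of_int (\<Sum>l\<in>UNIV. m $ l * A $ l $ k) \<le> real_of_int 0"
      unfolding of_int_le_iff using le[of k] minimal[of k] by linarith
    then show ?thesis
      by (simp add: x_def)
  qed
  define u where "u l = x l / x r - c l" for l
  have xr: "0 < x r"
    using pos by (simp add: x_def)
  have u: "x l - c l * x r = u l * x r" for l
    using xr by (simp add: u_def field_simps)
  show ?thesis
  proof
    show "u r = 0"
      using xr by (simp add: u_def)
    have "0 \<le> u l" for l
    proof (cases "l = r")
      case False
      have "a l l * (u l * x r) \<le> 0"
        using row[of l] row_leaf[OF False, of x] by (simp add: u)
      then show ?thesis
        using diag_neg[of l] xr by (simp add: mult_le_0_iff zero_le_mult_iff)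
    qed (simp add: \<open>u r = 0\<close>)
    then show "\<forall>l. 0 \<le> u l" ..
    have "(\<Delta> + (\<Sum>l\<in>UNIV - {r}. a l r * u l)) * x r \<le> 0"
      using row[of r] row_root[of x, unfolded u]
      by (simp add: distrib_right sum_distrib_right mult.assoc)
    then show "\<Delta> + (\<Sum>l\<in>UNIV - {r}. a l r * u l) \<le> 0"
      using xr by (simp add: mult_le_0_iff)
    show "c i + u i < c j + u j"
      using less xr by (simp add: u_def x_def divide_strict_right_mono)
  qed
qed

text \<open>In contrast to \<open>NN_pair_imp\<close>, the root inequality is strict; this leaves
  room to enlarge \<open>u\<close> slightly at the leaves before scaling and rounding.\<close>

lemma NN_pair_if:
  assumes "u r = 0" "\<And>l. 0 \<le> u l" "\<Delta> + (\<Sum>l\<in>UNIV - {r}. a l r * u l) < 0"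
    and less: "c i + u i < c j + u j"
  shows "NN_pair A K i j"
proof -
  \<comment> \<open>Adding \<open>\<epsilon>\<close> at every leaf makes the leaf inequalities strict.\<close>
  define w where "w \<epsilon> l = u l + (if l = r then 0 else \<epsilon>)" for \<epsilon> l
  have lim: "((\<lambda>\<epsilon>. w \<epsilon> l) \<longlongrightarrow> u l) (at_right 0)" for l
  proof -
    have "((\<lambda>\<epsilon>. w \<epsilon> l) \<longlongrightarrow> u l + (if l = r then 0 else 0)) (at_right 0)"
      unfolding w_def by (cases "l = r") (auto intro!: tendsto_eq_intros)
    then show ?thesis
      by simp
  qed
  have "eventually (\<lambda>\<epsilon>. \<Delta> + (\<Sum>l\<in>UNIV - {r}. a l r * w \<epsilon> l) < 0) (at_right 0)"
  proof (rule order_tendstoD(2))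
    show "((\<lambda>\<epsilon>. \<Delta> + (\<Sum>l\<in>UNIV - {r}. a l r * w \<epsilon> l)) \<longlongrightarrow>
        \<Delta> + (\<Sum>l\<in>UNIV - {r}. a l r * u l)) (at_right 0)"
      by (intro tendsto_add tendsto_const tendsto_sum tendsto_mult lim)
  qed (rule assms(3))
  moreover have "eventually (\<lambda>\<epsilon>. 0 < (c j + w \<epsilon> j) - (c i + w \<epsilon> i)) (at_right 0)"
  proof (rule order_tendstoD(1))
    show "((\<lambda>\<epsilon>. (c j + w \<epsilon> j) - (c i + w \<epsilon> i)) \<longlongrightarrow> (c j + u j) - (c i + u i)) (at_right 0)"
      by (intro tendsto_diff tendsto_add tendsto_const lim)
  qed (use less in simp)
  moreover have "eventually (\<lambda>\<epsilon>::real. 0 < \<epsilon>) (at_right 0)"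
    by (simp add: eventually_at_right_less)
  ultimately have "eventually (\<lambda>\<epsilon>. 0 < \<epsilon> \<and> \<Delta> + (\<Sum>l\<in>UNIV - {r}. a l r * w \<epsilon> l) < 0 \<and>
      0 < (c j + w \<epsilon> j) - (c i + w \<epsilon> i)) (at_right 0)"
    by eventually_elim simp
  then obtain \<epsilon> where \<epsilon>: "0 < \<epsilon>" "\<Delta> + (\<Sum>l\<in>UNIV - {r}. a l r * w \<epsilon> l) < 0"
      "0 < (c j + w \<epsilon> j) - (c i + w \<epsilon> i)"
    using eventually_happens'[OF trivial_limit_at_right_real] by blast
  define x where "x l = c l + w \<epsilon> l" for l
  have xr: "x r = 1"
    using assms(1) by (simp add: x_def w_def)
  show ?thesis
  proof (rule NN_pair_if_strict_real_solution)
    show "0 < x l" for l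
      using c_pos[of l] assms(2)[of l] \<epsilon>(1) unfolding x_def w_def by (auto split: if_split)
    show "x i < x j"
      using \<epsilon>(3) by (simp add: x_def)
    show "(\<Sum>l\<in>UNIV. x l * a l k) < 0" for k
    proof (cases "k = r")
      case True
      then show ?thesis
        using \<epsilon>(2) row_root[of x] xr by (simp add: x_def)
    next
      case False
      have "0 < w \<epsilon> k"
        using assms(2)[of k] \<epsilon>(1) False by (simp add: w_def add_nonneg_pos)
      then show ?thesis
        using row_leaf[OF False, of x] xr diag_neg[of k] by (simp add: x_def mult_neg_pos)
    qed
  qed
qed

text \<open>Since \<open>u\<close> is nonnegative and zero at the root, \<open>u = 0\<close> is the
  best choice; it is admissible because \<Delta> is negative.\<close>

lemma NN_pair_root_iff: "NN_pair A K i r \<longleftrightarrow> c i < 1"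
proof
  assume "NN_pair A K i r"
  then obtain u where "u r = 0" "\<forall>l. 0 \<le> u l"
    "\<Delta> + (\<Sum>l\<in>UNIV - {r}. a l r * u l) \<le> 0" "c i + u i < c r + u r"
    by (rule NN_pair_imp)
  from this(1,4) spec[OF this(2), of i] show "c i < 1"
    by simp
next
  assume "c i < 1"
  then show "NN_pair A K i r"
    using Delta_neg by (intro NN_pair_if[where u = "\<lambda>_. 0"]) auto
qed

text \<open>The value \<open>u j\<close> must exceed \<open>c i - c j\<close>, while the root
  inequality caps \<open>a j r * u j\<close> at \<open>- \<Delta>\<close>. The strict comparison of
  coordinates makes up for the weak root inequality of \<open>NN_pair_imp\<close>. The source
  \<open>i\<close> may be the root.\<close>

lemma NN_pair_leaf_iff:
  assumes "i \<noteq> j" "j \<noteq> r"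
  shows "NN_pair A K i j \<longleftrightarrow> \<Delta> + a j r * (c i - c j) < 0"
proof
  assume "NN_pair A K i j"
  then obtain u where "u r = 0" and u: "\<forall>l. 0 \<le> u l"
    "\<Delta> + (\<Sum>l\<in>UNIV - {r}. a l r * u l) \<le> 0"
    "c i + u i < c j + u j"
    by (rule NN_pair_imp)
  have "a j r * (c i - c j) < a j r * u j"
    using spec[OF u(1), of i] u(3) edge_pos[OF assms(2)] by simp
  also have "\<dots> \<le> (\<Sum>l\<in>UNIV - {r}. a l r * u l)"
    using assms(2) edge_pos u(1) by (intro member_le_sum) (auto simp: less_imp_le)
  finally show "\<Delta> + a j r * (c i - c j) < 0"
    using u(2) by linarith
next
  assume neg: "\<Delta> + a j r * (c i - c j) < 0"
  have pos: "0 < a j r"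
    by (rule edge_pos[OF assms(2)])
  \<comment> \<open>The maximum with 0 keeps the chosen \<open>T\<close> nonnegative; 0 lies below
    the cap because \<Delta> is negative.\<close>
  have "max 0 (c i - c j) < - \<Delta> / a j r"
    using neg pos Delta_neg by (simp add: field_simps)
  then obtain T where T: "max 0 (c i - c j) < T" "T < - \<Delta> / a j r"
    using dense by blast
  have "(\<Sum>l\<in>UNIV - {r}. a l r * (if l = j then T else 0)) = a j r * T"
    using assms(2) by (simp add: if_distrib sum.delta cong: if_cong)
  moreover have "\<Delta> + a j r * T < 0"
    using T(2) pos by (simp add: field_simps)
  ultimately show "NN_pair A K i j"
    using T(1) assms by (intro NN_pair_if[where u = "\<lambda>l. if l = j then T else 0"]) auto
qed

section \<open>Translation into intersection numbers\<close>

lemma leaf_condition_root: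
  assumes "i \<noteq> r"
  shows "c i < 1 \<longleftrightarrow> a i i + a i r < 0"
proof -
  have "a i i < 0"
    using diag_neg by simp
  then show ?thesis
    using assms by (auto simp: c_def field_simps)
qed

lemma leaf_condition_from_root:
  assumes "j \<noteq> r"
  shows "\<Delta> + a j r * (c r - c j) < 0 \<longleftrightarrow> a j r / a j j * (a j j + a j r) + \<Delta> < 0"
  using assms diag_neg[of j] by (simp add: c_def field_simps)

text \<open>Multiplication by the positive number \<open>a i i * a j j\<close> clears the
  denominators of \<open>c i\<close> and \<open>c j\<close>.\<close>

lemma leaf_condition_leaves:
  assumes "i \<noteq> r" "j \<noteq> r"
  shows "\<Delta> + a j r * (c i - c j) < 0 \<longleftrightarrow>
    a i i * a j j * \<Delta> + a j r * (a i i * a j r - a j j * a i r) < 0"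
proof -
  have "a i i * a j j * \<Delta> + a j r * (a i i * a j r - a j j * a i r) =
      a i i * a j j * (\<Delta> + a j r * (c i - c j))"
    using assms diag_neg[of i] diag_neg[of j] by (simp add: c_def field_simps)
  moreover have "0 < a i i * a j j"
    using diag_neg[of i] diag_neg[of j] by (simp add: mult_neg_neg)
  ultimately show ?thesis
    using mult_less_cancel_left_pos[of "a i i * a j j" "\<Delta> + a j r * (c i - c j)" 0] by simp
qed

lemma NN_iff:
  "NN A K \<longleftrightarrow>
    (\<forall>i. i \<noteq> r \<longrightarrow> a i i + a i r < 0) \<and>
    (\<forall>i j. i \<noteq> r \<longrightarrow> j \<noteq> r \<longrightarrow>
       a i i * a j j * \<Delta> + a j r * (a i i * a j r - a j j * a i r) < 0) \<and>
    (\<forall>i. i \<noteq> r \<longrightarrow> a i r / a i i * (a i i + a i r) + \<Delta> < 0)"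
proof -
  have "NN A K \<longleftrightarrow>
    (\<forall>i. i \<noteq> r \<longrightarrow> NN_pair A K i r) \<and>
    (\<forall>i j. i \<noteq> r \<longrightarrow> j \<noteq> r \<longrightarrow> i \<noteq> j \<longrightarrow> NN_pair A K i j) \<and>
    (\<forall>i. i \<noteq> r \<longrightarrow> NN_pair A K r i)"
    (is "_ \<longleftrightarrow> ?parts")
  proof
    assume ?parts
    then have "NN_pair A K i j" if "i \<noteq> j" for i j
      using that by (cases "i = r"; cases "j = r") simp_all
    then show "NN A K"
      by (simp add: NN_def)
  qed (simp add: NN_def)
  also have "\<dots> \<longleftrightarrow>
    (\<forall>i. i \<noteq> r \<longrightarrow> c i < 1) \<and>
    (\<forall>i j. i \<noteq> r \<longrightarrow> j \<noteq> r \<longrightarrow> \<Delta> + a j r * (c i - c j) < 0) \<and>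
    (\<forall>i. i \<noteq> r \<longrightarrow> \<Delta> + a i r * (c r - c i) < 0)"
  proof -
    \<comment> \<open>The second condition also ranges over \<open>i = j\<close>, where no pair
      condition exists; there it reduces to \<open>\<Delta> < 0\<close>, which negative definiteness
      supplies.\<close>
    have leaf: "(i \<noteq> j \<longrightarrow> NN_pair A K i j) \<longleftrightarrow> \<Delta> + a j r * (c i - c j) < 0" if "j \<noteq> r" for i j
      using that Delta_neg by (cases "i = j") (simp_all add: NN_pair_leaf_iff)
    have from_root: "NN_pair A K r j \<longleftrightarrow> \<Delta> + a j r * (c r - c j) < 0" if "j \<noteq> r" for j
      using leaf[OF that, of r] that by auto
    show ?thesis
      by (intro conj_cong all_cong1 imp_cong refl NN_pair_root_iff leaf from_root)
  qed
  also have "\<dots> \<longleftrightarrow>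
    (\<forall>i. i \<noteq> r \<longrightarrow> a i i + a i r < 0) \<and>
    (\<forall>i j. i \<noteq> r \<longrightarrow> j \<noteq> r \<longrightarrow>
       a i i * a j j * \<Delta> + a j r * (a i i * a j r - a j j * a i r) < 0) \<and>
    (\<forall>i. i \<noteq> r \<longrightarrow> a i r / a i i * (a i i + a i r) + \<Delta> < 0)"
    by (intro conj_cong all_cong1 imp_cong refl leaf_condition_root leaf_condition_leaves
        leaf_condition_from_root)
  finally show ?thesis .
qed

end

theorem theorem7:
  fixes A :: "int^'n^'n" and K :: "int^'n" and M :: "real^'n^'n" and r :: 'n
  shows
    "(minimal_resolution_data A K \<and> is_star (dual_graph A) r \<longrightarrow>
        (let a = (\<lambda>i j. real_of_int (A $ i $ j));
             \<Delta> = star_Delta (map_matrix real_of_int A) r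
         in NN A K \<longleftrightarrow>
            (\<forall>i. i \<noteq> r \<longrightarrow> a i i + a i r < 0) \<and>
            (\<forall>i j. i \<noteq> r \<longrightarrow> j \<noteq> r \<longrightarrow>
               a i i * a j j * \<Delta> + a j r * (a i i * a j r - a j j * a i r) < 0) \<and>
            (\<forall>i. i \<noteq> r \<longrightarrow> a i r / a i i * (a i i + a i r) + \<Delta> < 0)))
     \<and>
     (transpose M = M \<and>
      (\<forall>i. i \<noteq> r \<longrightarrow> M $ i $ i < 0) \<and>
      (\<forall>i j. i \<noteq> r \<longrightarrow> j \<noteq> r \<longrightarrow> i \<noteq> j \<longrightarrow> M $ i $ j = 0) \<longrightarrow>
        (negative_definite M \<longleftrightarrow> star_Delta M r < 0))"
proof (intro conjI impI)
  assume "minimal_resolution_data A K \<and> is_star (dual_graph A) r"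
  then interpret star_resolution A K r
    by (simp add: star_resolution_def star_resolution_axioms_def)
  show "let a = (\<lambda>i j. real_of_int (A $ i $ j));
          \<Delta> = star_Delta (map_matrix real_of_int A) r
        in NN A K \<longleftrightarrow>
          (\<forall>i. i \<noteq> r \<longrightarrow> a i i + a i r < 0) \<and>
          (\<forall>i j. i \<noteq> r \<longrightarrow> j \<noteq> r \<longrightarrow>
             a i i * a j j * \<Delta> + a j r * (a i i * a j r - a j j * a i r) < 0) \<and>
          (\<forall>i. i \<noteq> r \<longrightarrow> a i r / a i i * (a i i + a i r) + \<Delta> < 0)"
    unfolding Let_def by (rule NN_iff)
next
  assume "transpose M = M \<and> (\<forall>i. i \<noteq> r \<longrightarrow> M $ i $ i < 0) \<and>
    (\<forall>i j. i \<noteq> r \<longrightarrow> j \<noteq> r \<longrightarrow> i \<noteq> j \<longrightarrow> M $ i $ j = 0)"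
  then interpret star_matrix M r
    by unfold_locales auto
  show "negative_definite M \<longleftrightarrow> star_Delta M r < 0"
    by (rule negative_definite_iff)
qed

end
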